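(* For every $n\ge 1$, there is an exact affine OBDD with the identity variable order $(1,2,\dots,n)$, having $n$ classical states and $n$ affine states, that computes the hidden weighted bit function $\mathtt{HWB}_n$.
   Context: $\mathtt{HWB}_n:\{0,1\}^n\to\{0,1\}$ is defined by $\mathtt{HWB}_n(x)=x_z$ where $z=x_1+\dots+x_n$ and by convention $x_0=0$. An affine OBDD (AfOBDD) is a tuple $(S,E,\delta,T,s_I,v_0,S_a,E_a,\pi)$: $S=\{s_1,\dots,s_{m_1}\}$ is a finite set of classical states with initial state $s_I$ and accepting set $S_a\subseteq S$; $E=\{e_1,\dots,e_{m_2}\}$ is a set of affine states with accepting set $E_a\subseteq E$; $v_0\in\mathbb{R}^{m_2}$ is an initial affine state, where an affine state is a real column vector whose entries sum to $1$; $\pi$ is a permutation of $\{1,\dots,n\}$; for each step $i$, $\delta_i:S\times\{0,1\}\to S$ is a classical transition function; and for each step $i$, classical state $s$ and bit $b$ there is an affine operator $T_i^{s,b}$, i.e. a real $m_2\times m_2$ matrix each of whose columns sums to $1$. On input $x$ the machine starts in $(s_I,v_0)$; at step $j$, if the current pair is $(s,v_{j-1})$, it sets $v_j=T_j^{s,x_{\pi(j)}}v_{j-1}$ and then the classical state to $\delta_j(s,x_{\pi(j)})$. If the final classical state is not in $S_a$ the input is rejected; otherwise the input is accepted with probability $\sum_{e_i\in E_a}|v_f[i]|/\|v_f\|_1$ where $v_f$ is the final affine state. Its width is $m_1m_2$. It computes $f$ exactly (with zero error) if every $x$ with $f(x)=1$ is accepted with probability $1$ and every $x$ with $f(x)=0$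 is accepted with probability $0$.
   Formalization: The theorem is stated for n ≥ 2 instead of n ≥ 1: for n = 1 the claim fails, since an affine OBDD with one classical and one affine state has constant acceptance probability while HWB_1(x) = x_1. *)

theory Defs
  imports
    "HOL-Library.FuncSet"
    "HOL-Combinatorics.Permutations"
    "Jordan_Normal_Form.Matrix"
begin

definition cube :: "nat \<Rightarrow> (nat \<Rightarrow> nat) set" where
  "cube n = {1..n} \<rightarrow>\<^sub>E {0, 1}"

definition HWB :: "nat \<Rightarrow> (nat \<Rightarrow> nat) \<Rightarrow> nat" where
  "HWB n x = (let z = (\<Sum>i = 1..n. x i) in if z = 0 then 0 else x z)"

definition affine_state :: "nat \<Rightarrow> real vec \<Rightarrow> bool" where
  "affine_state m v \<longleftrightarrow> v \<in> carrier_vec m \<and> (\<Sum>i<m. v $ i) = 1"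

definition affine_operator :: "nat \<Rightarrow> real mat \<Rightarrow> bool" where
  "affine_operator m A \<longleftrightarrow>
     A \<in> carrier_mat m m \<and> (\<forall>j<m. (\<Sum>i<m. A $$ (i, j)) = 1)"

text \<open>
  Classical and affine states are represented by their indices, counted from 0: the state sets are
  \<open>{..<num_classical M}\<close> and \<open>{..<num_affine M}\<close>. Steps and input variables are counted from 1.
\<close>

record afobdd =
  num_classical :: nat
  num_affine :: nat
  trans :: "nat \<Rightarrow> nat \<Rightarrow> nat \<Rightarrow> nat"           \<comment> \<open>step, classical state, bit\<close>
  aff_op :: "nat \<Rightarrow> nat \<Rightarrow> nat \<Rightarrow> real mat"     \<comment> \<open>step, classical state, bit\<close>
  init_classical :: nat
  init_affine :: "real vec"
  acc_classical :: "nat set"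
  acc_affine :: "nat set"
  var_order :: "nat \<Rightarrow> nat"

definition is_afobdd :: "nat \<Rightarrow> afobdd \<Rightarrow> bool" where
  "is_afobdd n M \<longleftrightarrow>
     init_classical M < num_classical M \<and>
     acc_classical M \<subseteq> {..<num_classical M} \<and>
     affine_state (num_affine M) (init_affine M) \<and>
     acc_affine M \<subseteq> {..<num_affine M} \<and>
     var_order M permutes {1..n} \<and>
     (\<forall>i\<in>{1..n}. \<forall>s<num_classical M. \<forall>b\<in>{0, 1}.
        trans M i s b < num_classical M \<and>
        affine_operator (num_affine M) (aff_op M i s b))"

primrec config :: "afobdd \<Rightarrow> (nat \<Rightarrow> nat) \<Rightarrow> nat \<Rightarrow> nat \<times> real vec" where
  "config M x 0 = (init_classical M, init_affine M)"
| "config M x (Suc j) =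
     (let (s, v) = config M x j; b = x (var_order M (Suc j))
      in (trans M (Suc j) s b, aff_op M (Suc j) s b *\<^sub>v v))"

definition accept_prob :: "nat \<Rightarrow> afobdd \<Rightarrow> (nat \<Rightarrow> nat) \<Rightarrow> real" where
  "accept_prob n M x =
     (let (s, v) = config M x n
      in if s \<in> acc_classical M
         then (\<Sum>i\<in>acc_affine M. \<bar>v $ i\<bar>) / (\<Sum>i<num_affine M. \<bar>v $ i\<bar>)
         else 0)"

definition computes_exactly :: "nat \<Rightarrow> afobdd \<Rightarrow> ((nat \<Rightarrow> nat) \<Rightarrow> nat) \<Rightarrow> bool" where
  "computes_exactly n M f \<longleftrightarrow>
     (\<forall>x\<in>cube n. (f x = 1 \<longrightarrow> accept_prob n M x = 1) \<and> (f x = 0 \<longrightarrow> accept_prob n M x = 0))"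

text \<open>
  For \<open>n = 1\<close>, no machine with one classical and one affine state computes \<open>HWB 1\<close>: its
  acceptance probability is constant, while \<open>HWB 1 x = x 1\<close>. Hence the assumption \<open>n \<ge> 2\<close> in
  the main statement.
\<close>

lemma no_exact_HWB_1:
  assumes M: "is_afobdd 1 M" and m: "num_classical M = 1" "num_affine M = 1"
  shows "\<not> computes_exactly 1 M (HWB 1)"
proof
  assume C: "computes_exactly 1 M (HWB 1)"
  have const: "accept_prob 1 M x =
      (if 0 \<in> acc_classical M then (\<Sum>i\<in>acc_affine M. 1) else 0)" if x: "x \<in> cube 1" for x
  proof -
    have "var_order M = id"
      using M unfolding is_afobdd_def by simp
    then have vo: "var_order M (Suc 0) = Suc 0" by simp
    have xb: "x (Suc 0) \<in> {0, 1}" using x unfolding cube_def by (auto simp: PiE_def Pi_def)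
    have i0: "init_classical M = 0" using M m unfolding is_afobdd_def by simp
    define A where "A = aff_op M (Suc 0) 0 (x (Suc 0))"
    have tA: "trans M (Suc 0) 0 (x (Suc 0)) = 0 \<and> affine_operator 1 A"
      using M m xb unfolding is_afobdd_def A_def by auto
    have v0: "init_affine M \<in> carrier_vec 1" "init_affine M $ 0 = 1"
      using M m unfolding is_afobdd_def affine_state_def by auto
    have A: "A \<in> carrier_mat 1 1" "A $$ (0, 0) = 1"
      using tA unfolding affine_operator_def by auto
    have v: "(A *\<^sub>v init_affine M) $ 0 = 1"
      using A v0 by (simp add: scalar_prod_def)
    have cf: "config M x 1 = (0, A *\<^sub>v init_affine M)"
      using tA by (simp add: i0 vo A_def)
    have acc: "acc_affine M \<subseteq> {0}" using M m unfolding is_afobdd_def by auto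
    have "(\<Sum>i\<in>acc_affine M. \<bar>(A *\<^sub>v init_affine M) $ i\<bar>) = (\<Sum>i\<in>acc_affine M. 1)"
      by (rule sum.cong) (use acc v in auto)
    then show ?thesis
      unfolding accept_prob_def cf using v m by simp
  qed
  define x0 x1 :: "nat \<Rightarrow> nat" where
    "x0 = (\<lambda>i\<in>{1..1}. 0)" and "x1 = (\<lambda>i\<in>{1..1}. 1)"
  have x: "x0 \<in> cube 1" "x1 \<in> cube 1" unfolding cube_def x0_def x1_def by auto
  have "HWB 1 x0 = 0" "HWB 1 x1 = 1" unfolding HWB_def x0_def x1_def by simp_all
  then have "accept_prob 1 M x0 = 0" "accept_prob 1 M x1 = 1"
    using C x unfolding computes_exactly_def by blast+
  then show False using const[OF x(1)] const[OF x(2)] by simp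
qed

end

theory Submission
  imports Defs
begin

text \<open>
  The machine counts the ones among the first \<open>n - 1\<close> bits in its classical state and stores these
  bits in the affine state \<open>(1 - (x\<^sub>1 + \<dots> + x\<^sub>n\<^sub>-\<^sub>1), x\<^sub>1, \<dots>, x\<^sub>n\<^sub>-\<^sub>1)\<close>. When the last bit is read,
  the classical state and that bit determine the weight \<open>z\<close>, so the last operator can depend on
  \<open>z\<close>: it moves entry \<open>z\<close> to the accepting position \<open>0\<close> and adds all other entries up in
  position \<open>1\<close>, which gives \<open>(x\<^sub>z, 1 - x\<^sub>z, 0, \<dots>, 0)\<close>. If \<open>z = 0\<close> or \<open>z = n\<close>, the whole mass goes to
  position \<open>1\<close> or \<open>0\<close>, respectively.
\<close>

text \<open>On affine states, this is the translation by \<open>b (e\<^sub>i - e\<^sub>0)\<close>.\<close>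

definition store_op :: "nat \<Rightarrow> nat \<Rightarrow> nat \<Rightarrow> real mat" where
  "store_op n i b = mat n n (\<lambda>(r, j).
     of_bool (r = j) + real b * (of_bool (r = i) - of_bool (r = 0)))"

text \<open>The row index \<open>of_bool (j \<notin> J)\<close> is 0 for columns in \<open>J\<close>
  and 1 for all others.\<close>

definition select_op :: "nat \<Rightarrow> nat set \<Rightarrow> real mat" where
  "select_op n J = mat n n (\<lambda>(r, j). of_bool (r = of_bool (j \<notin> J)))"

text \<open>For \<open>z = n\<close> the needed bit \<open>x n\<close> is not stored, but it must be
  1, which is the total mass. For \<open>z = 0\<close> the set is empty, matching the convention
  that the value is 0.\<close>

definition select_set :: "nat \<Rightarrow> nat \<Rightarrow> nat set" where
  "select_set n z = (if z = n then {..<n} else {z} - {0})"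

definition stored_bits :: "nat \<Rightarrow> (nat \<Rightarrow> nat) \<Rightarrow> nat \<Rightarrow> real vec" where
  "stored_bits n x j = vec n (\<lambda>r.
     if r = 0 then 1 - (\<Sum>i = 1..j. real (x i)) else if r \<le> j then real (x r) else 0)"

text \<open>There is no state \<open>n\<close>, hence the cap. On inputs from the cube it can only
  act at the last bit, after which every state accepts; \<open>aff_op\<close> uses the uncapped
  \<open>s + b\<close>.\<close>

definition HWB_machine :: "nat \<Rightarrow> afobdd" where
  "HWB_machine n =
     \<lparr>num_classical = n, num_affine = n,
      trans = (\<lambda>i s b. min (n - 1) (s + b)),
      aff_op = (\<lambda>i s b. if i < n then store_op n i b else select_op n (select_set n (s + b))),
      init_classical = 0, init_affine = unit_vec n 0,
      acc_classical = {..<n}, acc_affine = {0}, var_order = id\<rparr>"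

lemma HWB_machine_simps [simp]:
  "num_classical (HWB_machine n) = n"
  "num_affine (HWB_machine n) = n"
  "trans (HWB_machine n) i s b = min (n - 1) (s + b)"
  "aff_op (HWB_machine n) i s b =
     (if i < n then store_op n i b else select_op n (select_set n (s + b)))"
  "init_classical (HWB_machine n) = 0"
  "init_affine (HWB_machine n) = unit_vec n 0"
  "acc_classical (HWB_machine n) = {..<n}"
  "acc_affine (HWB_machine n) = {0}"
  "var_order (HWB_machine n) = id"
  by (simp_all add: HWB_machine_def)

lemma affine_operator_store_op:
  assumes "i < n"
  shows "affine_operator n (store_op n i b)"
proof -
  have "(\<Sum>r<n. of_bool (r = j) + real b * (of_bool (r = i) - of_bool (r = 0))) = (1::real)"
    if "j < n" for j
    using assms that
    by (simp add: sum.distrib sum_subtractf flip: sum_distrib_left)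
  then show ?thesis
    by (simp add: affine_operator_def store_op_def)
qed

text \<open>Row 1 must exist to receive the columns outside \<open>J\<close>, hence
  \<open>n \<ge> 2\<close>.\<close>

lemma affine_operator_select_op:
  assumes "n \<ge> 2"
  shows "affine_operator n (select_op n J)"
proof -
  have "(\<Sum>r<n. of_bool (r = of_bool (j \<notin> J))) = (1::real)" for j
    using assms by (cases "j \<in> J") (simp_all add: of_bool_def)
  then show ?thesis
    by (simp add: affine_operator_def select_op_def)
qed

lemma is_afobdd_HWB_machine:
  assumes "n \<ge> 2"
  shows "is_afobdd n (HWB_machine n)"
proof -
  have "affine_state n (unit_vec n 0)"
    using assms by (simp add: affine_state_def unit_vec_def)
  then show ?thesis
    using assms affine_operator_store_op affine_operator_select_op
    by (auto simp: is_afobdd_def permutes_id)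
qed

lemma stored_bits_carrier: "stored_bits n x j \<in> carrier_vec n"
  by (simp add: stored_bits_def)

lemma sum_stored_bits:
  assumes "j < n"
  shows "(\<Sum>r<n. stored_bits n x j $ r) = 1"
proof -
  have "(\<Sum>r<n. stored_bits n x j $ r) =
      stored_bits n x j $ 0 + (\<Sum>r\<in>{1..<n}. stored_bits n x j $ r)"
    using assms by (simp add: lessThan_atLeast0 sum.atLeast_Suc_lessThan)
  also have "(\<Sum>r\<in>{1..<n}. stored_bits n x j $ r) = (\<Sum>r\<in>{1..j}. stored_bits n x j $ r)"
    using assms by (intro sum.mono_neutral_right) (auto simp: stored_bits_def)
  also have "\<dots> = (\<Sum>r = 1..j. real (x r))"
    using assms by (intro sum.cong) (auto simp: stored_bits_def)
  also have "stored_bits n x j $ 0 + \<dots> = 1"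
    using assms by (simp add: stored_bits_def)
  finally show ?thesis .
qed

text \<open>The correction term is the same in every column, so the product multiplies it by the sum
  of the entries of \<open>v\<close>, which is 1. This is how a linear map acts as a
  translation.\<close>

lemma store_op_mult_vec:
  assumes "v \<in> carrier_vec n" and "(\<Sum>j<n. v $ j) = 1" and "r < n"
  shows "(store_op n i b *\<^sub>v v) $ r = v $ r + real b * (of_bool (r = i) - of_bool (r = 0))"
proof -
  let ?c = "real b * (of_bool (r = i) - of_bool (r = 0))"
  have "(store_op n i b *\<^sub>v v) $ r = (\<Sum>j<n. (of_bool (r = j) + ?c) * v $ j)"
    using assms by (simp add: store_op_def scalar_prod_def lessThan_atLeast0)
  also have "\<dots> = (\<Sum>j<n. of_bool (r = j) * v $ j) + ?c * (\<Sum>j<n. v $ j)"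
    by (simp only: distrib_right sum.distrib sum_distrib_left)
  also have "(\<Sum>j<n. of_bool (r = j) * v $ j) = (\<Sum>j<n. if r = j then v $ j else 0)"
    by (intro sum.cong) auto
  finally show ?thesis
    using assms by simp
qed

lemma store_op_stored_bits:
  assumes "Suc j < n"
  shows "store_op n (Suc j) (x (Suc j)) *\<^sub>v stored_bits n x j = stored_bits n x (Suc j)"
proof (rule eq_vecI)
  fix r
  assume "r < dim_vec (stored_bits n x (Suc j))"
  then have r: "r < n"
    by (simp add: stored_bits_def)
  \<comment> \<open>Entry \<open>Suc j\<close> is 0 so far, so the translation writes the new bit
    there.\<close>
  show "(store_op n (Suc j) (x (Suc j)) *\<^sub>v stored_bits n x j) $ r = stored_bits n x (Suc j) $ r"
    unfolding store_op_mult_vec[OF stored_bits_carrier sum_stored_bits[OF Suc_lessD[OF assms]] r]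
    using r by (auto simp: stored_bits_def le_Suc_eq)
qed (simp add: store_op_def stored_bits_def)

lemma select_op_mult_vec:
  assumes "v \<in> carrier_vec n" and "(\<Sum>j<n. v $ j) = 1" and "J \<subseteq> {..<n}" and "r < n"
  shows "(select_op n J *\<^sub>v v) $ r =
    (if r = 0 then \<Sum>j\<in>J. v $ j else if r = 1 then 1 - (\<Sum>j\<in>J. v $ j) else 0)"
proof -
  have *: "(select_op n J *\<^sub>v v) $ r = (\<Sum>j<n. of_bool (r = of_bool (j \<notin> J)) * v $ j)"
    using assms by (simp add: select_op_def scalar_prod_def lessThan_atLeast0)
  have J: "(\<Sum>j<n. of_bool (j \<in> J) * v $ j) = (\<Sum>j\<in>J. v $ j)"
    using assms(3) by (intro sum.mono_neutral_cong_right) auto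
  have "(\<Sum>j<n. of_bool (j \<notin> J) * v $ j) = (\<Sum>j<n. v $ j) - (\<Sum>j<n. of_bool (j \<in> J) * v $ j)"
    unfolding sum_subtractf[symmetric] by (intro sum.cong) auto
  then have notJ: "(\<Sum>j<n. of_bool (j \<notin> J) * v $ j) = 1 - (\<Sum>j\<in>J. v $ j)"
    using assms(2) J by simp
  consider "r = 0" | "r = 1" | "r \<ge> 2" by linarith
  then show ?thesis
  proof cases
    case 1
    have "(\<Sum>j<n. of_bool (r = of_bool (j \<notin> J)) * v $ j) = (\<Sum>j<n. of_bool (j \<in> J) * v $ j)"
      using 1 by (intro sum.cong) auto
    then show ?thesis using * J 1 by simp
  next
    case 2
    have "(\<Sum>j<n. of_bool (r = of_bool (j \<notin> J)) * v $ j) = (\<Sum>j<n. of_bool (j \<notin> J) * v $ j)"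
      using 2 by (intro sum.cong) auto
    then show ?thesis using * notJ 2 by simp
  next
    case 3
    then have "(\<Sum>j<n. of_bool (r = of_bool (j \<notin> J)) * v $ j) = 0"
      by (intro sum.neutral) auto
    then show ?thesis using * 3 by simp
  qed
qed

lemma sum_bits_le:
  assumes "x \<in> cube n" and "j \<le> n"
  shows "(\<Sum>i = 1..j. x i) \<le> j"
proof -
  have "x i \<le> 1" if "i \<in> {1..j}" for i
  proof -
    have "x i \<in> {0, 1}"
      using assms that by (intro PiE_mem[of x "{1..n}" "\<lambda>_. {0, 1}"]) (auto simp: cube_def)
    then show ?thesis by auto
  qed
  then have "(\<Sum>i = 1..j. x i) \<le> (\<Sum>i = 1..j. 1)"
    by (rule sum_mono)
  then show ?thesis by simp
qed

lemma config_HWB_machine: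
  assumes x: "x \<in> cube n" and "j < n"
  shows "config (HWB_machine n) x j = (\<Sum>i = 1..j. x i, stored_bits n x j)"
  using \<open>j < n\<close>
proof (induction j)
  case 0
  then show ?case
    by (auto simp: unit_vec_def stored_bits_def)
next
  case (Suc j)
  \<comment> \<open>Only \<open>Suc j \<le> n - 1\<close> bits have been read, so the cap in
    \<open>trans\<close> does not act.\<close>
  have "(\<Sum>i = 1..Suc j. x i) \<le> n - 1"
    using sum_bits_le[OF x, of "Suc j"] Suc.prems by linarith
  then have "min (n - 1) ((\<Sum>i = 1..j. x i) + x (Suc j)) = (\<Sum>i = 1..Suc j. x i)"
    by simp
  then show ?case
    using Suc store_op_stored_bits[OF Suc.prems, of x] by simp
qed

lemma sum_select_set_stored_bits:
  assumes x: "x \<in> cube n" and "n \<ge> 2"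
  shows "(\<Sum>j\<in>select_set n (\<Sum>i = 1..n. x i). stored_bits n x (n - 1) $ j) = real (HWB n x)"
proof -
  define z where "z = (\<Sum>i = 1..n. x i)"
  have z: "z = (\<Sum>i = 1..n - 1. x i) + x n"
    unfolding z_def using assms by (cases n) auto
  have "z \<le> n"
    unfolding z_def using sum_bits_le[OF x] by simp
  then consider "z = 0" | "0 < z" "z < n" | "z = n" by linarith
  then have "(\<Sum>j\<in>select_set n z. stored_bits n x (n - 1) $ j) =
      real (if z = 0 then 0 else x z)"
  proof cases
    case 1
    then show ?thesis using assms by (simp add: select_set_def)
  next
    case 2
    then have "select_set n z = {z}" by (auto simp: select_set_def)
    then show ?thesis using 2 by (simp add: stored_bits_def)
  next
    case 3
    \<comment> \<open>The first \<open>n - 1\<close> bits contribute at most \<open>n - 1\<close> to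
      \<open>z = n\<close>, so the last bit is 1, as is the sum of all stored entries.\<close>
    have "x n \<in> {0, 1}"
      using assms by (intro PiE_mem[of x "{1..n}" "\<lambda>_. {0, 1}"]) (auto simp: cube_def)
    moreover have "(\<Sum>i = 1..n - 1. x i) \<le> n - 1"
      using sum_bits_le[OF x] by simp
    ultimately have "x n = 1"
      using 3 z assms by auto
    then show ?thesis
      using 3 assms sum_stored_bits[of "n - 1" n x] by (simp add: select_set_def)
  qed
  then show ?thesis
    by (simp add: HWB_def z_def Let_def)
qed

lemma accept_prob_HWB_machine:
  assumes x: "x \<in> cube n" and n: "n \<ge> 2" and bit: "HWB n x \<in> {0, 1}"
  shows "accept_prob n (HWB_machine n) x = real (HWB n x)"
proof -
  obtain m where m: "n = Suc m" using n by (cases n) auto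
  define z where "z = (\<Sum>i = 1..n. x i)"
  define w where "w = select_op n (select_set n z) *\<^sub>v stored_bits n x (n - 1)"
  have "z \<le> n"
    unfolding z_def using sum_bits_le[OF x] by simp
  then have "select_set n z \<subseteq> {..<n}"
    by (auto simp: select_set_def)
  then have w: "w $ r =
      (if r = 0 then real (HWB n x) else if r = 1 then 1 - real (HWB n x) else 0)" if "r < n" for r
    unfolding w_def using that n sum_select_set_stored_bits[OF x n]
    by (subst select_op_mult_vec[OF stored_bits_carrier sum_stored_bits]) (auto simp: z_def)
  \<comment> \<open>By \<open>bit\<close>, one of the entries 0 and 1 of \<open>w\<close> is 1 and
    the other is 0, so normalisation divides by 1.\<close>
  have "(\<Sum>r<n. \<bar>w $ r\<bar>) = (\<Sum>r\<in>{0, 1}. \<bar>w $ r\<bar>)"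
    using n w by (intro sum.mono_neutral_right) auto
  also have "\<dots> = 1"
    using n w bit by auto
  finally have norm: "(\<Sum>r<n. \<bar>w $ r\<bar>) = 1" .
  \<comment> \<open>In the last step, state plus bit is the full weight \<open>z\<close>, which
    selects the operator; only the new state is capped.\<close>
  have "config (HWB_machine n) x n = (min (n - 1) z, w)"
    using config_HWB_machine[OF x, of m] unfolding m by (simp add: w_def z_def m Let_def)
  then show ?thesis
    using n norm w[of 0] by (simp add: accept_prob_def)
qed

theorem theorem2:
  fixes n :: nat
  assumes "n \<ge> 2"
  shows "\<exists>M. is_afobdd n M \<and> var_order M = id \<and>
             num_classical M = n \<and> num_affine M = n \<and>
             computes_exactly n M (HWB n)"
proof -
  have "computes_exactly n (HWB_machine n) (HWB n)"
    unfolding computes_exactly_def using accept_prob_HWB_machine assms by auto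
  then show ?thesis
    using is_afobdd_HWB_machine[OF assms] by (intro exI[of _ "HWB_machine n"]) simp
qed

end
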